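(* Let $\pi\in\Pi(\mu_0,\mu_1)$ be equivalent to $\rho:=\mathbb{P}_0\circ(X_0,X_1)^{-1}$, such that the random variable $\zeta:=\frac{d\pi}{d\rho}(X_0,X_1)$ satisfies $$\mathbb{E}^{\mathbb{P}_0}\big[|\ln\zeta|+\zeta^2\big]<\infty.$$ Then the probability measure $\widehat{\mathbb{P}}$ defined by $\frac{d\widehat{\mathbb{P}}}{d\mathbb{P}_0}=\zeta$ is an element of $\mathcal{P}_2(\mu_0,\mu_1)$. Moreover, $\widehat{\mathbb{P}}$ is the unique minimizer of $\mathbf{H}(\cdot|\mathbb{P}_0)$ on $\mathcal{P}_\pi:=\{\mathbb{P}\in\mathcal{P}_2(\mu_0,\mu_1):\mathbb{P}\circ(X_0,X_1)^{-1}=\pi\}$.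
   Context: $\Omega=C([0,1],\mathbb{R}^d)$ is the canonical space with canonical process $X$. $\mu_0,\mu_1$ are Borel probability measures on $\mathbb{R}^d$. $\mathbb{P}_0$ is the Wiener measure on $\Omega$ with initial distribution $\mu_0$: $\mathbb{P}_0\circ X_0^{-1}=\mu_0$ and $(X_t-X_0)_{t\in[0,1]}$ is a $\mathbb{P}_0$-Brownian motion independent of $X_0$. $\Pi(\mu_0,\mu_1)$ is the set of probability measures on $\mathbb{R}^d\times\mathbb{R}^d$ with first marginal $\mu_0$ and second marginal $\mu_1$. $\mathcal{P}_2(\mu_0)$ is the set of Borel probability measures $\mathbb{P}$ on $\Omega$ equivalent to $\mathbb{P}_0$, with $\mathbb{P}\circ X_0^{-1}=\mu_0$, $\ln(\frac{d\mathbb{P}}{d\mathbb{P}_0})\in\mathbb{L}^1(\mathbb{P}_0)$ and $\frac{d\mathbb{P}}{d\mathbb{P}_0}\in\mathbb{L}^2(\mathbb{P}_0)$; and $\mathcal{P}_2(\mu_0,\mu_1)=\{\mathbb{P}\in\mathcal{P}_2(\mu_0):\mathbb{P}\circ X_1^{-1}=\mu_1\}$. For probability measures, $\mathbf{H}(\mathbb{Q}_1|\mathbb{Q}_0)=\mathbb{E}^{\mathbb{Q}_1}\big[\ln\frac{d\mathbb{Q}_1}{d\mathbb{Q}_0}\big]$ if $\mathbb{Q}_1\ll\mathbb{Q}_0$, and $\mathbf{H}(\mathbb{Q}_1|\mathbb{Q}_0)=\infty$ otherwise. *)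

theory Defs
  imports "HOL-Probability.Probability"
begin

(* Paths are represented as functions on the reals that are undefined outside [0,1], so that
   equality of paths is equality on [0,1].  cfunspace carries the uniform distance; boundedness,
   which it also demands, is automatic here (see space_path_space). *)
definition path_topology :: "(real \<Rightarrow> real ^ 'd) topology" where
  "path_topology = mtopology_of (cfunspace (top_of_set {0..1}) euclidean_metric)"

definition path_space :: "(real \<Rightarrow> real ^ 'd) measure" where
  "path_space = sigma (topspace path_topology) {U. openin path_topology U}"

abbreviation (input) coord :: "real \<Rightarrow> (real \<Rightarrow> 'a) \<Rightarrow> 'a" where
  "coord t \<equiv> (\<lambda>\<omega>. \<omega> t)"

abbreviation (input) endpoints :: "(real \<Rightarrow> 'a) \<Rightarrow> 'a \<times> 'a" where
  "endpoints \<equiv> (\<lambda>\<omega>. (coord 0 \<omega>, coord 1 \<omega>))"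

(* Standard d-dimensional Brownian motion on the time interval [0,1], started at 0: the increment
   over [s,t] has law N(0, (t - s) I), i.e. its density is the product of the one-dimensional
   normal densities of variance t - s. *)
definition brownian_motion :: "'w measure \<Rightarrow> (real \<Rightarrow> 'w \<Rightarrow> real ^ 'd) \<Rightarrow> bool" where
  "brownian_motion M B \<longleftrightarrow>
     prob_space M \<and>
     (\<forall>t\<in>{0..1}. B t \<in> borel_measurable M) \<and>
     (AE \<omega> in M. B 0 \<omega> = 0) \<and>
     (AE \<omega> in M. continuous_on {0..1} (\<lambda>t. B t \<omega>)) \<and>
     (\<forall>(n::nat) t. mono_on {..n} t \<longrightarrow> t ` {..n} \<subseteq> {0..1} \<longrightarrow>
        prob_space.indep_vars M (\<lambda>_. borel) (\<lambda>i \<omega>. B (t (Suc i)) \<omega> - B (t i) \<omega>) {..<n}) \<and>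
     (\<forall>s t. 0 \<le> s \<longrightarrow> s < t \<longrightarrow> t \<le> 1 \<longrightarrow>
        distributed M lborel (\<lambda>\<omega>. B t \<omega> - B s \<omega>)
          (\<lambda>x. ennreal (\<Prod>i\<in>UNIV. normal_density 0 (sqrt (t - s)) (x $ i))))"

(* The library's indep_var needs both random variables to have values in the same type, so the
   independence of X_0 and the process (X_t - X_0) is stated for the sigma-algebras they generate;
   for the process, the product sigma-algebra over all times is pulled back. *)
definition wiener_measure :: "(real ^ 'd) measure \<Rightarrow> (real \<Rightarrow> real ^ 'd) measure \<Rightarrow> bool" where
  "wiener_measure \<mu>\<^sub>0 P \<longleftrightarrow>
     prob_space P \<and> sets P = sets path_space \<and>
     distr P borel (coord 0) = \<mu>\<^sub>0 \<and>
     brownian_motion P (\<lambda>t \<omega>. coord t \<omega> - coord 0 \<omega>) \<and>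
     prob_space.indep_set P
       (sets (vimage_algebra (space P) (coord 0) (borel :: (real ^ 'd) measure)))
       (sets (vimage_algebra (space P) (\<lambda>\<omega>. \<lambda>t\<in>{0..1}. coord t \<omega> - coord 0 \<omega>)
         (\<Pi>\<^sub>M t\<in>{0..1}. (borel :: (real ^ 'd) measure))))"

definition equivalent_measures :: "'a measure \<Rightarrow> 'a measure \<Rightarrow> bool" where
  "equivalent_measures M N \<longleftrightarrow> absolutely_continuous M N \<and> absolutely_continuous N M"

definition couplings ::
    "(real ^ 'd) measure \<Rightarrow> (real ^ 'd) measure \<Rightarrow> ((real ^ 'd) \<times> (real ^ 'd)) measure set" where
  "couplings \<mu>\<^sub>0 \<mu>\<^sub>1 =
     {\<pi>. prob_space \<pi> \<and> sets \<pi> = sets borel \<and> distr \<pi> borel fst = \<mu>\<^sub>0 \<and> distr \<pi> borel snd = \<mu>\<^sub>1}"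

definition P2_init ::
    "(real \<Rightarrow> real ^ 'd) measure \<Rightarrow> (real ^ 'd) measure \<Rightarrow> (real \<Rightarrow> real ^ 'd) measure set" where
  "P2_init P\<^sub>0 \<mu>\<^sub>0 =
     {P. prob_space P \<and> sets P = sets path_space \<and> equivalent_measures P\<^sub>0 P \<and>
         distr P borel (coord 0) = \<mu>\<^sub>0 \<and>
         integrable P\<^sub>0 (\<lambda>\<omega>. ln (enn2real (RN_deriv P\<^sub>0 P \<omega>))) \<and>
         integrable P\<^sub>0 (\<lambda>\<omega>. (enn2real (RN_deriv P\<^sub>0 P \<omega>))\<^sup>2)}"

definition P2 ::
    "(real \<Rightarrow> real ^ 'd) measure \<Rightarrow> (real ^ 'd) measure \<Rightarrow> (real ^ 'd) measure
      \<Rightarrow> (real \<Rightarrow> real ^ 'd) measure set" where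
  "P2 P\<^sub>0 \<mu>\<^sub>0 \<mu>\<^sub>1 = {P \<in> P2_init P\<^sub>0 \<mu>\<^sub>0. distr P borel (coord 1) = \<mu>\<^sub>1}"

definition P2_coupling ::
    "(real \<Rightarrow> real ^ 'd) measure \<Rightarrow> (real ^ 'd) measure \<Rightarrow> (real ^ 'd) measure
      \<Rightarrow> ((real ^ 'd) \<times> (real ^ 'd)) measure \<Rightarrow> (real \<Rightarrow> real ^ 'd) measure set" where
  "P2_coupling P\<^sub>0 \<mu>\<^sub>0 \<mu>\<^sub>1 \<pi> = {P \<in> P2 P\<^sub>0 \<mu>\<^sub>0 \<mu>\<^sub>1. distr P borel endpoints = \<pi>}"

(* The expectation is taken in the extended reals, as positive part minus negative part: the
   logarithm of the density need not be integrable.  KL_divergence is real-valued and would be 0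
   in that case.  The negative part always has finite integral for probability measures. *)
definition relative_entropy :: "'a measure \<Rightarrow> 'a measure \<Rightarrow> ereal" where
  "relative_entropy Q\<^sub>1 Q\<^sub>0 =
     (if absolutely_continuous Q\<^sub>0 Q\<^sub>1
      then enn2ereal (\<integral>\<^sup>+ \<omega>. ennreal (ln (enn2real (RN_deriv Q\<^sub>0 Q\<^sub>1 \<omega>))) \<partial>Q\<^sub>1)
         - enn2ereal (\<integral>\<^sup>+ \<omega>. ennreal (- ln (enn2real (RN_deriv Q\<^sub>0 Q\<^sub>1 \<omega>))) \<partial>Q\<^sub>1)
      else \<infinity>)"

lemma topspace_path_topology:
  "topspace (path_topology :: (real \<Rightarrow> real ^ 'd) topology)
     = {\<omega> \<in> extensional {0..1}. continuous_on {0..1} \<omega>}"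
proof -
  have bounded: "bounded (\<omega> ` {0..1})" if "continuous_on {0..1} \<omega>" for \<omega> :: "real \<Rightarrow> real ^ 'd"
  proof (rule compact_imp_bounded, rule compact_continuous_image)
    show "continuous_on {0..1} \<omega>" by (fact that)
  qed (rule compact_Icc)
  show ?thesis
    unfolding path_topology_def
    by (simp only: topspace_mtopology_of mspace_cfunspace mspace_euclidean_metric
          mdist_euclidean_metric topspace_euclidean_subtopology mbounded_iff_bounded
          mtopology_of_euclidean continuous_map_iff_continuous) (blast intro: bounded)
qed

lemma space_path_space:
  "space (path_space :: (real \<Rightarrow> real ^ 'd) measure)
     = {\<omega> \<in> extensional {0..1}. continuous_on {0..1} \<omega>}"
  by (simp add: path_space_def topspace_path_topology space_measure_of_conv)

lemma sets_path_space:
  "sets path_space = sigma_sets (topspace path_topology) {U. openin path_topology U}"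
  unfolding path_space_def by (intro sets_measure_of) (auto dest: openin_subset)

lemma coord_continuous:
  assumes "t \<in> {0..1}"
  shows "continuous_map path_topology euclidean (coord t :: (real \<Rightarrow> real ^ 'd) \<Rightarrow> real ^ 'd)"
proof -
  let ?m = "cfunspace (top_of_set {0..1::real}) euclidean_metric :: (real \<Rightarrow> real ^ 'd) metric"
  have "Lipschitz_continuous_map ?m euclidean_metric (coord t)"
    unfolding Lipschitz_continuous_map_def
  proof (intro conjI exI[of _ 1] ballI)
    fix f g assume fg: "f \<in> mspace ?m" "g \<in> mspace ?m"
    have "mdist euclidean_metric (f t) (g t) \<le> mdist ?m f g"
      by (rule mdist_cfunspace_imp_mdist_le[OF fg order_refl]) (use assms in simp)
    then show "mdist euclidean_metric (coord t f) (coord t g) \<le> 1 * mdist ?m f g"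
      by simp
  qed (simp only: mspace_euclidean_metric Pi_UNIV UNIV_I)
  from Lipschitz_continuous_imp_continuous_map[OF this] show ?thesis
    by (simp only: path_topology_def mtopology_of_euclidean)
qed

lemma coord_measurable:
  assumes "t \<in> {0..1}"
  shows "(coord t :: (real \<Rightarrow> real ^ 'd) \<Rightarrow> real ^ 'd) \<in> borel_measurable path_space"
proof (rule borel_measurableI)
  fix S :: "(real ^ 'd) set" assume "open S"
  then have "openin path_topology {\<omega> \<in> topspace path_topology. coord t \<omega> \<in> S}"
    by (intro openin_continuous_map_preimage[OF coord_continuous[OF assms]]) (simp only: open_openin)
  moreover have "coord t -` S \<inter> space path_space = {\<omega> \<in> topspace path_topology. coord t \<omega> \<in> S}"
    unfolding space_path_space topspace_path_topology by blast
  ultimately show "coord t -` S \<inter> space path_space \<in> sets path_space"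
    unfolding sets_path_space by (simp only: sigma_sets.Basic mem_Collect_eq)
qed

end

theory Submission
  imports Defs
begin

text \<open>
  Let \<open>q\<close> be the density of a competitor \<open>Q\<close>.  Since \<open>ln \<zeta>\<close> is a function of the endpoints,
  whose law is \<open>\<pi>\<close> under both \<open>Q\<close> and the candidate, \<open>ln \<zeta>\<close> has the same expectation under both.
  Hence the two entropies differ by the \<open>P\<^sub>0\<close>-integral of \<open>\<zeta> - q - q (ln \<zeta> - ln q)\<close>, which is
  nonnegative and vanishes only where \<open>q = \<zeta>\<close>.
\<close>

text \<open>The tangent bound \<open>ln t \<le> t - 1\<close> at \<open>t = a / b\<close>, scaled by
  \<open>b\<close>. With \<open>a = p x\<close> and \<open>b = q x\<close> it is the pointwise form
  of Gibbs' inequality.\<close>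

lemma mult_ln_diff_le:
  fixes a b :: real
  assumes "0 < a" "0 < b"
  shows "b * (ln a - ln b) \<le> a - b"
proof -
  have "ln (a / b) \<le> a / b - 1" using assms by (intro ln_le_minus_one) simp
  then have "b * ln (a / b) \<le> b * (a / b - 1)" using assms by (intro mult_left_mono) simp_all
  moreover have "b * (a / b - 1) = a - b" using assms by (simp add: field_simps)
  ultimately show ?thesis using assms by (simp add: ln_div)
qed

text \<open>The tangent touches the graph of \<open>ln\<close> only at 1. The uniqueness of the
  minimizer rests on this.\<close>

lemma mult_ln_diff_eq_imp:
  fixes a b :: real
  assumes "0 < a" "0 < b" "b * (ln a - ln b) = a - b"
  shows "a = b"
proof -
  have "ln (a / b) = a / b - 1" using assms by (simp add: ln_div field_simps)
  then have "a / b = 1" using assms by (intro ln_eq_minus_one) simp_all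
  then show ?thesis using assms by simp
qed

text \<open>Where \<open>q x \<le> 1\<close> the product is dominated by the logarithm. Elsewhere
  \<open>0 \<le> ln y \<le> y\<close> makes it at most the square. So the two integrability
  conditions of \<open>P2_init\<close> give finite entropy.\<close>

lemma integrable_mult_ln:
  fixes q :: "'a \<Rightarrow> real"
  assumes q: "q \<in> borel_measurable M" and pos: "AE x in M. 0 < q x"
    and ln: "integrable M (\<lambda>x. ln (q x))" and sq: "integrable M (\<lambda>x. (q x)\<^sup>2)"
  shows "integrable M (\<lambda>x. q x * ln (q x))"
proof (rule Bochner_Integration.integrable_bound[where f = "\<lambda>x. \<bar>ln (q x)\<bar> + (q x)\<^sup>2"])
  show "integrable M (\<lambda>x. \<bar>ln (q x)\<bar> + (q x)\<^sup>2)" using ln sq by simp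
  show "(\<lambda>x. q x * ln (q x)) \<in> borel_measurable M" using q by simp
  have "\<bar>y * ln y\<bar> \<le> \<bar>ln y\<bar> + y\<^sup>2" if "0 < y" for y :: real
  proof (cases "y \<le> 1")
    case True
    then have "y * \<bar>ln y\<bar> \<le> 1 * \<bar>ln y\<bar>" by (intro mult_right_mono) simp_all
    then show ?thesis using that by (simp add: abs_mult add_increasing2)
  next
    case False
    then have "y * ln y \<le> y * y" "0 \<le> ln y"
      using ln_le_minus_one[OF that] that by auto
    then show ?thesis using that by (simp add: abs_mult power2_eq_square add_increasing)
  qed
  then show "AE x in M. norm (q x * ln (q x)) \<le> norm (\<bar>ln (q x)\<bar> + (q x)\<^sup>2)"
    using pos by (auto elim!: eventually_mono)
qed

text \<open>\<open>density M f\<close> gives no mass to the zero set of \<open>f\<close>, so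
  equivalence makes that set null for \<open>M\<close>. Conversely, \<open>f\<close> vanishes almost
  everywhere on any null set of the density, which leaves only null sets of \<open>M\<close> if
  \<open>f\<close> has almost no zeros.\<close>

lemma equivalent_measures_density_iff:
  assumes f: "f \<in> borel_measurable M"
  shows "equivalent_measures M (density M f) \<longleftrightarrow> (AE x in M. f x \<noteq> 0)"
proof
  assume "equivalent_measures M (density M f)"
  then have "null_sets (density M f) \<subseteq> null_sets M"
    by (simp add: equivalent_measures_def absolutely_continuous_def)
  moreover have "AE x in density M f. f x \<noteq> 0"
    using f by (simp add: AE_density zero_less_iff_neq_zero)
  ultimately show "AE x in M. f x \<noteq> 0"
    by (auto simp: eventually_ae_filter)
next
  assume pos: "AE x in M. f x \<noteq> 0"
  have "A \<in> null_sets M" if "A \<in> sets M" "AE x\<in>A in M. f x = 0" for A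
  proof -
    have "AE x in M. x \<notin> A" using pos that(2) by eventually_elim simp
    then show ?thesis using that(1) by (simp add: AE_iff_null_sets)
  qed
  then have "absolutely_continuous (density M f) M"
    using f by (auto simp: absolutely_continuous_def null_sets_density_iff)
  then show "equivalent_measures M (density M f)"
    using f by (simp add: equivalent_measures_def absolutely_continuousI_density)
qed

text \<open>Nonnegativity enters because \<open>ennreal\<close> truncates negative values to
  0.\<close>

lemma (in sigma_finite_measure) RN_deriv_density_real:
  fixes q :: "'a \<Rightarrow> real"
  assumes "q \<in> borel_measurable M" and "AE x in M. 0 \<le> q x"
  shows "AE x in M. enn2real (RN_deriv M (density M q) x) = q x"
proof -
  have "AE x in M. ennreal (q x) = RN_deriv M (density M q) x"
    using assms(1) by (intro RN_deriv_unique) simp_all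
  then show ?thesis using assms(2)
    by eventually_elim (metis enn2real_ennreal)
qed

text \<open>\<open>enn2real\<close> sends infinity to 0, so the derivative must be finite almost
  everywhere; sigma-finiteness of \<open>N\<close> ensures this.\<close>

lemma (in sigma_finite_measure) density_enn2real_RN_deriv:
  assumes "absolutely_continuous M N" "sets N = sets M" "sigma_finite_measure N"
  shows "density M (\<lambda>x. ennreal (enn2real (RN_deriv M N x))) = N"
proof -
  have "AE x in M. ennreal (enn2real (RN_deriv M N x)) = RN_deriv M N x"
    using RN_deriv_finite[OF assms(3,1,2)] by eventually_elim (simp add: top.not_eq_extremum)
  then have "density M (\<lambda>x. ennreal (enn2real (RN_deriv M N x))) = density M (RN_deriv M N)"
    by (intro density_cong) simp_all
  then show ?thesis using density_RN_deriv[OF assms(1,2)] by simp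
qed

lemma (in sigma_finite_measure) relative_entropy_density:
  fixes q :: "'a \<Rightarrow> real"
  assumes q: "q \<in> borel_measurable M" and nonneg: "AE x in M. 0 \<le> q x"
    and int: "integrable M (\<lambda>x. q x * ln (q x))"
  shows "relative_entropy (density M q) M = ereal (\<integral>x. q x * ln (q x) \<partial>M)"
proof -
  let ?Q = "density M (\<lambda>x. ennreal (q x))" and ?r = "\<lambda>x. enn2real (RN_deriv M (density M q) x)"
  have r: "AE x in ?Q. ?r x = q x"
    using RN_deriv_density_real[OF q nonneg] q by (subst AE_density) (auto elim: eventually_mono)
  have intQ: "integrable ?Q (\<lambda>x. ln (q x))"
    using int q nonneg by (simp add: integrable_density)
  have "absolutely_continuous M ?Q"
    using q by (intro absolutely_continuousI_density) simp
  moreover have "(\<integral>\<^sup>+ x. ennreal (ln (?r x)) \<partial>?Q) = (\<integral>\<^sup>+ x. ennreal (ln (q x)) \<partial>?Q)"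
    "(\<integral>\<^sup>+ x. ennreal (- ln (?r x)) \<partial>?Q) = (\<integral>\<^sup>+ x. ennreal (- ln (q x)) \<partial>?Q)"
    using r by (auto intro!: nn_integral_cong_AE elim: eventually_mono)
  \<comment> \<open>\<open>u\<close> and \<open>v\<close> are the integrals of the positive and the
    negative part of \<open>ln (q x)\<close>. Both are finite, so the extended difference in the
    definition is the real number \<open>u - v\<close>.\<close>
  moreover obtain u v where "0 \<le> u" "0 \<le> v"
    "(\<integral>\<^sup>+ x. ennreal (ln (q x)) \<partial>?Q) = ennreal u"
    "(\<integral>\<^sup>+ x. ennreal (- ln (q x)) \<partial>?Q) = ennreal v"
    "(\<integral>x. ln (q x) \<partial>?Q) = u - v"
    using intQ by (rule integrableE)
  moreover have "(\<integral>x. ln (q x) \<partial>?Q) = (\<integral>x. q x * ln (q x) \<partial>M)"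
    using q nonneg by (simp add: integral_density)
  ultimately show ?thesis
    by (simp add: relative_entropy_def enn2ereal_ennreal)
qed

text \<open>Gibbs' inequality in strict form. Finite integrals on both sides allow subtracting them,
  and equal masses cancel the linear terms.\<close>

lemma integral_mult_ln_less:
  fixes p q :: "'a \<Rightarrow> real"
  assumes [measurable]: "p \<in> borel_measurable M" "q \<in> borel_measurable M"
    and pos: "AE x in M. 0 < p x" "AE x in M. 0 < q x"
    and int: "integrable M p" "integrable M q" "integrable M (\<lambda>x. q x * ln (p x))"
      "integrable M (\<lambda>x. q x * ln (q x))"
    and mass: "integral\<^sup>L M p = integral\<^sup>L M q"
    and neq: "\<not> (AE x in M. p x = q x)"
  shows "(\<integral>x. q x * ln (p x) \<partial>M) < (\<integral>x. q x * ln (q x) \<partial>M)"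
proof -
  \<comment> \<open>The gap in the pointwise inequality: nonnegative almost everywhere, so a zero
    integral would force \<open>D x = 0\<close> and hence \<open>p x = q x\<close> almost
    everywhere.\<close>
  define D where "D x = p x - q x - (q x * ln (p x) - q x * ln (q x))" for x
  have intD: "integrable M D" unfolding D_def using int by auto
  have D_nonneg: "AE x in M. 0 \<le> D x"
    using pos by eventually_elim (use mult_ln_diff_le in \<open>force simp: D_def algebra_simps\<close>)
  have "integral\<^sup>L M D \<noteq> 0"
  proof
    assume "integral\<^sup>L M D = 0"
    then have "AE x in M. D x = 0"
      using integral_nonneg_eq_0_iff_AE[OF intD D_nonneg] by simp
    then have "AE x in M. p x = q x"
      using pos
      by eventually_elim (rule mult_ln_diff_eq_imp, auto simp: D_def algebra_simps)
    with neq show False ..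
  qed
  moreover have "0 \<le> integral\<^sup>L M D" using D_nonneg by (rule integral_nonneg_AE)
  moreover have "integral\<^sup>L M D = (\<integral>x. q x * ln (q x) \<partial>M) - (\<integral>x. q x * ln (p x) \<partial>M)"
    unfolding D_def using int mass by simp
  ultimately show ?thesis by simp
qed

text \<open>Abstract core of the minimization: \<open>X\<close> stands for the endpoint map,
  \<open>g\<close> for the density of \<pi> with respect to \<rho>, and \<open>q\<close> for the
  density of a competitor.\<close>

lemma (in prob_space) relative_entropy_less_of_distr_eq:
  fixes g :: "'b \<Rightarrow> real" and q :: "'a \<Rightarrow> real"
  assumes X[measurable]: "X \<in> measurable M N" and g[measurable]: "g \<in> borel_measurable N"
    and q[measurable]: "q \<in> borel_measurable M"
    and pos: "AE x in M. 0 < g (X x)" "AE x in M. 0 < q x"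
    and prob: "prob_space (density M (\<lambda>x. g (X x)))" "prob_space (density M q)"
    and int: "integrable M (\<lambda>x. g (X x) * ln (g (X x)))" "integrable M (\<lambda>x. q x * ln (q x))"
    and distr: "distr (density M q) N X = distr (density M (\<lambda>x. g (X x))) N X"
    and neq: "density M q \<noteq> density M (\<lambda>x. g (X x))"
  shows "relative_entropy (density M (\<lambda>x. g (X x))) M < relative_entropy (density M q) M"
proof -
  let ?p = "\<lambda>x. g (X x)"
  have nonneg: "AE x in M. 0 \<le> ?p x" "AE x in M. 0 \<le> q x"
    using pos by (auto elim: eventually_mono)
  have mass: "integrable M f \<and> integral\<^sup>L M f = 1"
    if "prob_space (density M f)" "AE x in M. 0 \<le> f x" "f \<in> borel_measurable M" for f :: "'a \<Rightarrow> real"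
  proof -
    have "(\<integral>\<^sup>+ x. ennreal (f x) \<partial>M) = ennreal 1"
      using prob_space.emeasure_space_1[OF that(1)] that(3)
      by (simp add: emeasure_density cong: nn_integral_cong)
    then have "has_bochner_integral M f 1"
      using that by (intro has_bochner_integral_nn_integral) simp_all
    then show ?thesis by (simp add: has_bochner_integral_iff)
  qed
  \<comment> \<open>Integrability of the cross term is derived by transport: push
    \<open>ln (?p x)\<close> forward to the common law of \<open>X\<close>, then pull it back to
    \<open>density M q\<close>.\<close>
  have "integrable (density M ?p) (\<lambda>x. ln (?p x))"
    using int(1) nonneg by (simp add: integrable_density)
  then have "integrable (distr (density M ?p) N X) (\<lambda>y. ln (g y))"
    by (subst integrable_distr_eq) simp_all
  then have "integrable (density M q) (\<lambda>x. ln (?p x))"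
    unfolding distr[symmetric] by (subst (asm) integrable_distr_eq) simp_all
  then have cross: "integrable M (\<lambda>x. q x * ln (?p x))"
    using nonneg by (simp add: integrable_density)
  \<comment> \<open>The same route for the values turns the candidate's entropy into the cross term,
    to which Gibbs' inequality applies.\<close>
  have "(\<integral>x. ?p x * ln (?p x) \<partial>M) = (\<integral>x. ln (?p x) \<partial>density M ?p)"
    using nonneg by (simp add: integral_density)
  also have "\<dots> = (\<integral>y. ln (g y) \<partial>distr (density M ?p) N X)"
    by (subst integral_distr) simp_all
  also have "\<dots> = (\<integral>x. ln (?p x) \<partial>density M q)"
    unfolding distr[symmetric] by (subst integral_distr) simp_all
  also have "\<dots> = (\<integral>x. q x * ln (?p x) \<partial>M)"
    using nonneg by (simp add: integral_density)
  also have "\<dots> < (\<integral>x. q x * ln (q x) \<partial>M)"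
  proof (rule integral_mult_ln_less)
    show "\<not> (AE x in M. ?p x = q x)"
    proof
      assume "AE x in M. ?p x = q x"
      then have "density M q = density M (\<lambda>x. ?p x)"
        by (intro density_cong) (auto elim: eventually_mono)
      with neq show False ..
    qed
  qed (use mass[OF prob(1) nonneg(1)] mass[OF prob(2) nonneg(2)] pos cross int in simp_all)
  finally show ?thesis
    using nonneg int by (simp add: relative_entropy_density)
qed

lemma endpoints_measurable:
  "(endpoints :: (real \<Rightarrow> real ^ 'd) \<Rightarrow> _) \<in> borel_measurable path_space"
  by (intro borel_measurable_Pair coord_measurable) simp_all

text \<open>Replaces the Radon-Nikodym derivative by a real density in the form required for the
  entropy comparison. Its positivity comes from the equivalence of the two measures.\<close>

lemma P2_initE:
  assumes "prob_space P\<^sub>0" "P \<in> P2_init P\<^sub>0 \<mu>\<^sub>0" and sets: "sets P\<^sub>0 = sets path_space"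
  obtains q where "q \<in> borel_measurable P\<^sub>0" "P = density P\<^sub>0 (\<lambda>\<omega>. ennreal (q \<omega>))"
    "prob_space P" "AE \<omega> in P\<^sub>0. 0 < q \<omega>" "integrable P\<^sub>0 (\<lambda>\<omega>. q \<omega> * ln (q \<omega>))"
proof
  interpret P\<^sub>0: prob_space P\<^sub>0 by fact
  let ?q = "\<lambda>\<omega>. enn2real (RN_deriv P\<^sub>0 P \<omega>)"
  have P: "prob_space P" "sets P = sets P\<^sub>0" "equivalent_measures P\<^sub>0 P"
    and int: "integrable P\<^sub>0 (\<lambda>\<omega>. ln (?q \<omega>))" "integrable P\<^sub>0 (\<lambda>\<omega>. (?q \<omega>)\<^sup>2)"
    using assms by (simp_all add: P2_init_def)
  show q: "?q \<in> borel_measurable P\<^sub>0" by simp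
  show dens: "P = density P\<^sub>0 (\<lambda>\<omega>. ennreal (?q \<omega>))"
    using P by (intro P\<^sub>0.density_enn2real_RN_deriv[symmetric])
      (auto simp: equivalent_measures_def prob_space_imp_sigma_finite)
  show "prob_space P" by fact
  have "AE \<omega> in P\<^sub>0. ennreal (?q \<omega>) \<noteq> 0"
    using P(3) dens by (subst equivalent_measures_density_iff[symmetric]) simp_all
  then show pos: "AE \<omega> in P\<^sub>0. 0 < ?q \<omega>" by eventually_elim (simp add: ennreal_eq_0_iff)
  show "integrable P\<^sub>0 (\<lambda>\<omega>. ?q \<omega> * ln (?q \<omega>))" by (rule integrable_mult_ln[OF q pos int])
qed

theorem proposition2p7:
  fixes \<mu>\<^sub>0 \<mu>\<^sub>1 :: "(real ^ 'd) measure"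
    and P\<^sub>0 :: "(real \<Rightarrow> real ^ 'd) measure"
    and \<pi> \<rho> :: "((real ^ 'd) \<times> (real ^ 'd)) measure"
    and \<zeta> :: "(real \<Rightarrow> real ^ 'd) \<Rightarrow> real"
  assumes "prob_space \<mu>\<^sub>0" and "sets \<mu>\<^sub>0 = sets borel"
    and "prob_space \<mu>\<^sub>1" and "sets \<mu>\<^sub>1 = sets borel"
    and "wiener_measure \<mu>\<^sub>0 P\<^sub>0"
    and "\<rho> = distr P\<^sub>0 borel endpoints"
    and "\<pi> \<in> couplings \<mu>\<^sub>0 \<mu>\<^sub>1"
    and "equivalent_measures \<rho> \<pi>"
    and "\<zeta> = (\<lambda>\<omega>. enn2real (RN_deriv \<rho> \<pi> (coord 0 \<omega>, coord 1 \<omega>)))"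
    and "integrable P\<^sub>0 (\<lambda>\<omega>. \<bar>ln (\<zeta> \<omega>)\<bar> + (\<zeta> \<omega>)\<^sup>2)"
  shows "density P\<^sub>0 (\<lambda>\<omega>. ennreal (\<zeta> \<omega>)) \<in> P2 P\<^sub>0 \<mu>\<^sub>0 \<mu>\<^sub>1
    \<and> (\<forall>P. is_arg_min (\<lambda>Q. relative_entropy Q P\<^sub>0) (\<lambda>Q. Q \<in> P2_coupling P\<^sub>0 \<mu>\<^sub>0 \<mu>\<^sub>1 \<pi>) P
             \<longleftrightarrow> P = density P\<^sub>0 (\<lambda>\<omega>. ennreal (\<zeta> \<omega>)))"
proof -
  let ?X = "endpoints :: (real \<Rightarrow> real ^ 'd) \<Rightarrow> _"
  let ?P = "density P\<^sub>0 (\<lambda>\<omega>. ennreal (\<zeta> \<omega>))"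
  \<comment> \<open>The density on pairs of endpoints, so that \<zeta> is visibly a function of the
    endpoint map.\<close>
  define g where "g y = enn2real (RN_deriv \<rho> \<pi> y)" for y
  have \<zeta>: "\<zeta> = (\<lambda>\<omega>. g (?X \<omega>))" by (simp add: assms(9) g_def)
  have "prob_space P\<^sub>0" and sets: "sets P\<^sub>0 = sets path_space"
    using assms(5) by (simp_all add: wiener_measure_def)
  then interpret P\<^sub>0: prob_space P\<^sub>0 by simp
  have coord[measurable]: "coord 0 \<in> borel_measurable P\<^sub>0" "coord 1 \<in> borel_measurable P\<^sub>0"
    unfolding measurable_cong_sets[OF sets refl] by (rule coord_measurable; simp)+
  have X[measurable]: "?X \<in> borel_measurable P\<^sub>0"
    using endpoints_measurable[where 'd = 'd] measurable_cong_sets[OF sets refl] by blast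
  have g[measurable]: "g \<in> borel_measurable borel"
    unfolding g_def using assms(6) by (simp add: measurable_cong_sets[of \<rho> borel])
  have \<zeta>_meas[measurable]: "\<zeta> \<in> borel_measurable P\<^sub>0" unfolding \<zeta> by measurable
  interpret \<rho>: prob_space \<rho> unfolding assms(6) by (rule P\<^sub>0.prob_space_distr) measurable
  have \<pi>: "prob_space \<pi>" "sets \<pi> = sets borel" "distr \<pi> borel fst = \<mu>\<^sub>0" "distr \<pi> borel snd = \<mu>\<^sub>1"
    using assms(7) by (simp_all add: couplings_def)
  have \<pi>_dens: "density \<rho> (\<lambda>y. ennreal (g y)) = \<pi>"
    unfolding g_def using assms(6,8) \<pi>
    by (intro \<rho>.density_enn2real_RN_deriv)
      (auto simp: equivalent_measures_def prob_space_imp_sigma_finite)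
  \<comment> \<open>Since the density factors through \<open>?X\<close>, the pushforward has density
    \<open>g\<close> with respect to \<rho>.\<close>
  have law: "distr ?P borel ?X = \<pi>"
    unfolding \<pi>_dens[symmetric] assms(6) \<zeta> by (subst density_distr) simp_all
  have "AE y in \<rho>. ennreal (g y) \<noteq> 0"
    using assms(8) \<pi>_dens assms(6) by (subst equivalent_measures_density_iff[symmetric]) simp_all
  then have pos: "AE \<omega> in P\<^sub>0. 0 < \<zeta> \<omega>"
    unfolding assms(6) \<zeta> by (subst (asm) AE_distr_iff) (simp_all add: ennreal_eq_0_iff not_le)
  have int: "integrable P\<^sub>0 (\<lambda>\<omega>. ln (\<zeta> \<omega>))" "integrable P\<^sub>0 (\<lambda>\<omega>. (\<zeta> \<omega>)\<^sup>2)"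
    by (rule Bochner_Integration.integrable_bound[OF assms(10)]; simp)+
  \<comment> \<open>The total mass is inherited from \<pi>, because a pushforward preserves
    mass.\<close>
  have prob: "prob_space ?P"
  proof (rule prob_space_distrD)
    show "?X \<in> measurable ?P borel" by simp
    show "prob_space (distr ?P borel ?X)" using law \<pi> by simp
  qed
  have "distr ?P borel (coord 0) = distr (distr ?P borel ?X) borel fst"
    "distr ?P borel (coord 1) = distr (distr ?P borel ?X) borel snd"
    by (subst distr_distr; simp add: comp_def borel_prod[symmetric])+
  then have marginals: "distr ?P borel (coord 0) = \<mu>\<^sub>0" "distr ?P borel (coord 1) = \<mu>\<^sub>1"
    using law \<pi> by simp_all
  \<comment> \<open>\<open>P2_init\<close> speaks of the chosen version of the derivative, which
    agrees with \<zeta> only almost everywhere; integrability is insensitive to this.\<close>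
  have RN: "AE \<omega> in P\<^sub>0. enn2real (RN_deriv P\<^sub>0 ?P \<omega>) = \<zeta> \<omega>"
    using pos by (intro P\<^sub>0.RN_deriv_density_real) (auto elim: eventually_mono)
  have "integrable P\<^sub>0 (\<lambda>\<omega>. ln (enn2real (RN_deriv P\<^sub>0 ?P \<omega>)))"
    "integrable P\<^sub>0 (\<lambda>\<omega>. (enn2real (RN_deriv P\<^sub>0 ?P \<omega>))\<^sup>2)"
    by (rule integrable_cong_AE_imp[OF int(1)] integrable_cong_AE_imp[OF int(2)];
        use RN in \<open>auto elim: eventually_mono\<close>)+
  moreover have "equivalent_measures P\<^sub>0 ?P"
    using pos by (subst equivalent_measures_density_iff) (auto elim: eventually_mono)
  ultimately have P2: "?P \<in> P2 P\<^sub>0 \<mu>\<^sub>0 \<mu>\<^sub>1"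
    using prob marginals sets by (simp add: P2_def P2_init_def)
  have coupling: "?P \<in> P2_coupling P\<^sub>0 \<mu>\<^sub>0 \<mu>\<^sub>1 \<pi>"
    using P2 law by (simp add: P2_coupling_def)
  have less: "relative_entropy ?P P\<^sub>0 < relative_entropy Q P\<^sub>0"
    if "Q \<in> P2_coupling P\<^sub>0 \<mu>\<^sub>0 \<mu>\<^sub>1 \<pi>" "Q \<noteq> ?P" for Q
  proof -
    have Q: "Q \<in> P2_init P\<^sub>0 \<mu>\<^sub>0" "distr Q borel ?X = \<pi>"
      using that by (simp_all add: P2_coupling_def P2_def)
    from \<open>prob_space P\<^sub>0\<close> Q(1) sets obtain q where q: "q \<in> borel_measurable P\<^sub>0"
      "Q = density P\<^sub>0 (\<lambda>\<omega>. ennreal (q \<omega>))" "prob_space Q" "AE \<omega> in P\<^sub>0. 0 < q \<omega>"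
      "integrable P\<^sub>0 (\<lambda>\<omega>. q \<omega> * ln (q \<omega>))"
      by (rule P2_initE)
    show ?thesis
      unfolding q(2) \<zeta>
      by (rule P\<^sub>0.relative_entropy_less_of_distr_eq[OF X g])
        (use q Q(2) that(2) pos prob law integrable_mult_ln[OF \<zeta>_meas pos int] \<zeta> in simp_all)
  qed
  \<comment> \<open>\<open>is_arg_min\<close> asks that no admissible measure be strictly smaller.
    Strictness of \<open>less\<close> gives this for \<open>?P\<close> by asymmetry, and excludes
    every other measure since \<open>?P\<close> itself is admissible.\<close>
  show ?thesis
    using P2 coupling less unfolding is_arg_min_def by (metis order.asym)
qed

end
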